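(* Let $A_k := k^3$ for $k\ge 0$ and, consequently, $a_k := A_k-A_{k-1}$ for $k\ge1$ and $\gamma_k := \frac{a_{k+1}}{A_{k+1}} = 1-\bigl(\frac{k}{k+1}\bigr)^3 = O(1/k)$. There is an absolute constant $C>0$ such that, for every sequence $\{x_k\}$ generated by the Contracting-Domain Newton Method I (defined in the context) with these coefficients $\gamma_k$, for all $k\ge1$, $$F(x_k)-F^* \;\le\; \ell_k := F(x_k)-\frac{\phi_k^*}{A_k} \;\le\; C\,\frac{H_\nu D^{2+\nu}}{k^{1+\nu}}.$$
   Context: Problem: minimize $F(x)=f(x)+\psi(x)$ over $x\in\mathbb{R}^n$, with optimal value $F^*$, where $\psi:\mathbb{R}^n\to\mathbb{R}\cup\{+\infty\}$ is a proper closed convex function and $f$ is convex and twice continuously differentiable at every point of $\operatorname{dom}\psi=\{x:\psi(x)<+\infty\}$. $\langle\cdot,\cdot\rangle$ is the standard scalar product on $\mathbb{R}^n$ and $\|\cdot\|$ is an arbitrary fixed (possibly non-Euclidean) norm on $\mathbb{R}^n$, with dual norm $\|s\|_*=\sup_{\|h\|\le 1}\langle s,h\rangle$ and induced matrix norm $\|A\|=\sup_{\|h\|\le1}\|Ah\|_*$. The domain is bounded: $D:=\sup_{x,y\in\operatorname{dom}\psi}\|x-y\|<+\infty$. The Hessian of $f$ is Hölder continuous of degree $\nu\in[0,1]$ on $\operatorname{dom}\psi$ with constant $0\le H_\nu<+\infty$: $\|\nabla^2 f(x)-\nabla^2 f(y)\|\le H_\nu\|x-y\|^\nu$ for all $x,y\in\operatorname{dom}\psi$.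 Contracting-Domain Newton Method I, with coefficients $\gamma_k\in(0,1]$: choose $x_0\in\operatorname{dom}\psi$; for $k\ge0$ take any $$v_{k+1}\in\operatorname{Argmin}_y\Bigl\{\langle\nabla f(x_k),y-x_k\rangle+\frac{\gamma_k}{2}\langle\nabla^2 f(x_k)(y-x_k),y-x_k\rangle+\psi(y)\Bigr\}$$ and set $x_{k+1}:=x_k+\gamma_k(v_{k+1}-x_k)$. Linear estimating functions: for $k\ge1$, $\phi_k(x):=\sum_{i=1}^k a_i\bigl[f(x_i)+\langle\nabla f(x_i),x-x_i\rangle+\psi(x)\bigr]$ and $\phi_k^*:=\min_x\phi_k(x)$. An absolute constant is one independent of $k$, $n$, $\nu$, $H_\nu$, $D$, $f$, $\psi$, the norm and $x_0$. *)

theory Defs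
  imports "HOL-Analysis.Analysis" "HOL-Analysis.Finite_Function_Topology"
    "HOL-Library.Landau_Symbols"
begin

text \<open>
  The constant in the convergence rate must not depend on the dimension, so the dimension has to
  be bound inside the statement and cannot be a type.  All spaces are therefore realised inside
  the single normed space of finitely supported real sequences, as the coordinate subspaces
  spanned by the first \<open>n\<close> unit vectors.  The ambient norm is the sum of absolute values; on each
  of these subspaces it induces the usual topology and the usual notion of derivative.
\<close>

type_synonym rvec = "nat \<Rightarrow>\<^sub>0 real"

definition Rn :: "nat \<Rightarrow> rvec set"
  where "Rn n = {x. \<forall>i\<ge>n. Poly_Mapping.lookup x i = 0}"

definition unit_vec :: "nat \<Rightarrow> rvec"
  where "unit_vec i = Poly_Mapping.single i 1"

definition scalar_prod :: "nat \<Rightarrow> rvec \<Rightarrow> rvec \<Rightarrow> real"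
  where "scalar_prod n x y = (\<Sum>i<n. Poly_Mapping.lookup x i * Poly_Mapping.lookup y i)"

definition norm_on :: "nat \<Rightarrow> (rvec \<Rightarrow> real) \<Rightarrow> bool"
  where "norm_on n N \<longleftrightarrow>
    (\<forall>x\<in>Rn n. 0 \<le> N x \<and> (N x = 0 \<longleftrightarrow> x = 0)) \<and>
    (\<forall>x\<in>Rn n. \<forall>c. N (c *\<^sub>R x) = \<bar>c\<bar> * N x) \<and>
    (\<forall>x\<in>Rn n. \<forall>y\<in>Rn n. N (x + y) \<le> N x + N y)"

definition dual_norm :: "nat \<Rightarrow> (rvec \<Rightarrow> real) \<Rightarrow> rvec \<Rightarrow> real"
  where "dual_norm n N s = (SUP h\<in>{h \<in> Rn n. N h \<le> 1}. scalar_prod n s h)"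

text \<open>A matrix is given by its action on vectors.\<close>

definition matrix_norm :: "nat \<Rightarrow> (rvec \<Rightarrow> real) \<Rightarrow> (rvec \<Rightarrow> rvec) \<Rightarrow> real"
  where "matrix_norm n N A = (SUP h\<in>{h \<in> Rn n. N h \<le> 1}. dual_norm n N (A h))"

text \<open>
  Derivatives are taken relative to \<open>Rn n\<close>, so only their values on vectors of \<open>Rn n\<close> are
  determined, and only these values are used below.
\<close>

definition gradient :: "nat \<Rightarrow> (rvec \<Rightarrow> real) \<Rightarrow> rvec \<Rightarrow> rvec"
  where "gradient n f x =
    (\<Sum>i<n. frechet_derivative f (at x within Rn n) (unit_vec i) *\<^sub>R unit_vec i)"

definition hessian :: "nat \<Rightarrow> (rvec \<Rightarrow> real) \<Rightarrow> rvec \<Rightarrow> rvec \<Rightarrow> rvec"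
  where "hessian n f x = frechet_derivative (gradient n f) (at x within Rn n)"

text \<open>
  Twice differentiable near \<open>x\<close>, with Hessian continuous at \<open>x\<close>.  In finite dimension, continuity
  of the Hessian applied to each fixed vector is continuity in any matrix norm.
\<close>

definition twice_cont_diff_at :: "nat \<Rightarrow> (rvec \<Rightarrow> real) \<Rightarrow> rvec \<Rightarrow> bool"
  where "twice_cont_diff_at n f x \<longleftrightarrow>
    (\<exists>U. open U \<and> x \<in> U \<and>
      (\<forall>y \<in> U \<inter> Rn n. f differentiable (at y within Rn n) \<and>
                      gradient n f differentiable (at y within Rn n))) \<and>
    (\<forall>h\<in>Rn n. continuous (at x within Rn n) (\<lambda>y. hessian n f y h))"

definition edom :: "nat \<Rightarrow> (rvec \<Rightarrow> ereal) \<Rightarrow> rvec set"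
  where "edom n \<psi> = {x \<in> Rn n. \<psi> x < \<infinity>}"

definition ereal_epigraph :: "nat \<Rightarrow> (rvec \<Rightarrow> ereal) \<Rightarrow> (rvec \<times> real) set"
  where "ereal_epigraph n \<psi> = {(x, t). x \<in> Rn n \<and> \<psi> x \<le> ereal t}"

definition proper_closed_convex :: "nat \<Rightarrow> (rvec \<Rightarrow> ereal) \<Rightarrow> bool"
  where "proper_closed_convex n \<psi> \<longleftrightarrow>
    (\<forall>x\<in>Rn n. \<psi> x \<noteq> -\<infinity>) \<and> edom n \<psi> \<noteq> {} \<and>
    closed (ereal_epigraph n \<psi>) \<and> convex (ereal_epigraph n \<psi>)"

definition dom_distances :: "nat \<Rightarrow> (rvec \<Rightarrow> real) \<Rightarrow> (rvec \<Rightarrow> ereal) \<Rightarrow> real set"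
  where "dom_distances n N \<psi> = {N (x - y) | x y. x \<in> edom n \<psi> \<and> y \<in> edom n \<psi>}"

definition hessian_Hoelder ::
    "nat \<Rightarrow> (rvec \<Rightarrow> real) \<Rightarrow> (rvec \<Rightarrow> real) \<Rightarrow> rvec set \<Rightarrow> real \<Rightarrow> real \<Rightarrow> bool"
  where "hessian_Hoelder n N f S \<nu> H \<longleftrightarrow>
    (\<forall>x\<in>S. \<forall>y\<in>S.
      matrix_norm n N (\<lambda>h. hessian n f x h - hessian n f y h) \<le> H * N (x - y) powr \<nu>)"

definition objective :: "(rvec \<Rightarrow> real) \<Rightarrow> (rvec \<Rightarrow> ereal) \<Rightarrow> rvec \<Rightarrow> ereal"
  where "objective f \<psi> x = ereal (f x) + \<psi> x"

definition optimal_value :: "nat \<Rightarrow> (rvec \<Rightarrow> real) \<Rightarrow> (rvec \<Rightarrow> ereal) \<Rightarrow> ereal"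
  where "optimal_value n f \<psi> = (INF x\<in>Rn n. objective f \<psi> x)"

definition newton_model ::
    "nat \<Rightarrow> (rvec \<Rightarrow> real) \<Rightarrow> (rvec \<Rightarrow> ereal) \<Rightarrow> real \<Rightarrow> rvec \<Rightarrow> rvec \<Rightarrow> ereal"
  where "newton_model n f \<psi> g x y =
    ereal (scalar_prod n (gradient n f x) (y - x)
      + g / 2 * scalar_prod n (hessian n f x (y - x)) (y - x)) + \<psi> y"

definition contracting_domain_newton ::
    "nat \<Rightarrow> (rvec \<Rightarrow> real) \<Rightarrow> (rvec \<Rightarrow> ereal) \<Rightarrow> (nat \<Rightarrow> real) \<Rightarrow> (nat \<Rightarrow> rvec) \<Rightarrow> bool"
  where "contracting_domain_newton n f \<psi> \<gamma> x \<longleftrightarrow>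
    x 0 \<in> edom n \<psi> \<and>
    (\<forall>k. \<exists>v. is_arg_min (newton_model n f \<psi> (\<gamma> k) (x k)) (\<lambda>y. y \<in> Rn n) v \<and>
             x (Suc k) = x k + \<gamma> k *\<^sub>R (v - x k))"

definition increment :: "(nat \<Rightarrow> real) \<Rightarrow> nat \<Rightarrow> real"
  where "increment A k = A k - A (k - 1)"

definition contraction_coeff :: "(nat \<Rightarrow> real) \<Rightarrow> nat \<Rightarrow> real"
  where "contraction_coeff A k = increment A (k + 1) / A (k + 1)"

definition estimating_fun ::
    "nat \<Rightarrow> (rvec \<Rightarrow> real) \<Rightarrow> (rvec \<Rightarrow> ereal) \<Rightarrow> (nat \<Rightarrow> real) \<Rightarrow> (nat \<Rightarrow> rvec) \<Rightarrow> nat \<Rightarrow> rvec \<Rightarrow> ereal"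
  where "estimating_fun n f \<psi> a x k y =
    (\<Sum>i=1..k. ereal (a i) *
      (ereal (f (x i) + scalar_prod n (gradient n f (x i)) (y - x i)) + \<psi> y))"

definition estimating_min ::
    "nat \<Rightarrow> (rvec \<Rightarrow> real) \<Rightarrow> (rvec \<Rightarrow> ereal) \<Rightarrow> (nat \<Rightarrow> real) \<Rightarrow> (nat \<Rightarrow> rvec) \<Rightarrow> nat \<Rightarrow> ereal"
  where "estimating_min n f \<psi> a x k = (INF y\<in>Rn n. estimating_fun n f \<psi> a x k y)"

definition accuracy_certificate ::
    "nat \<Rightarrow> (rvec \<Rightarrow> real) \<Rightarrow> (rvec \<Rightarrow> ereal) \<Rightarrow> (nat \<Rightarrow> real) \<Rightarrow> (nat \<Rightarrow> rvec) \<Rightarrow> nat \<Rightarrow> ereal"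
  where "accuracy_certificate n f \<psi> A x k =
    objective f \<psi> (x k) - estimating_min n f \<psi> (increment A) x k / ereal (A k)"

definition cubic_weight :: "nat \<Rightarrow> real"
  where "cubic_weight k = real k ^ 3"

end

theory Submission
  imports Defs
begin

text \<open>
  Write \<open>F = f + \<psi>\<close>, let \<open>x'\<close> be the iterate that follows \<open>x\<close>, with coefficient \<open>\<gamma>\<close>, and let \<open>v\<close> be
  the minimizer of the Newton model, so that \<open>x' - x = \<gamma> (v - x)\<close>.  The factor \<open>\<gamma>\<close> in front of the
  quadratic term makes the gradient of the smooth part of the model at \<open>v\<close> equal to \<open>\<nabla>f x + \<nabla>\<^sup>2f x (x' - x)\<close>, the
  linearization of \<open>\<nabla>f x'\<close>.  By Hoelder continuity of the Hessian, \<open>v\<close> therefore minimizes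
  \<open>\<langle>\<nabla>f x', y\<rangle> + \<psi> y\<close> over \<open>y\<close> up to an error of \<open>H D\<^sup>2\<^sup>+\<^sup>\<nu> \<gamma>\<^sup>1\<^sup>+\<^sup>\<nu>\<close>; this is
  \<open>contracted_newton_step\<close>.  It rests on the optimality condition \<open>newton_model_minimizer\<close>,
  which needs the symmetry of the Hessian, and on \<open>gradient_linearization_error\<close>.

  The point \<open>x'\<close> is the weighted mean of \<open>x\<close> and \<open>v\<close> with weights \<open>A\<^sub>k\<close> and \<open>a\<^sub>k\<^sub>+\<^sub>1\<close>.  Together with
  convexity of \<open>f\<close> and \<open>\<psi>\<close>, the approximate minimality of \<open>v\<close> gives, by induction on \<open>k\<close>,
  \<open>A\<^sub>k F(x\<^sub>k) \<le> \<phi>\<^sub>k(y) + H D\<^sup>2\<^sup>+\<^sup>\<nu> (\<Sum>i\<le>k. a\<^sub>i \<gamma>\<^sub>i\<^sub>-\<^sub>1\<^sup>1\<^sup>+\<^sup>\<nu>)\<close> for every \<open>y\<close> in the domain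
  (\<open>estimating_sequence\<close>).  Dividing by \<open>A\<^sub>k\<close> bounds the certificate \<open>\<ell>\<^sub>k\<close> from above; that it
  bounds the residual is the statement that \<open>\<phi>\<^sub>k / A\<^sub>k\<close> lies below \<open>F\<close>.

  For \<open>A\<^sub>k = k\<^sup>3\<close> one has \<open>a\<^sub>i \<le> 3 i\<^sup>2\<close> and \<open>\<gamma>\<^sub>i\<^sub>-\<^sub>1 \<le> 3 / i\<close>, so the sum is at most \<open>27 k\<^sup>2\<^sup>-\<^sup>\<nu>\<close>
  and \<open>C = 27\<close> will do.  The factor \<open>27\<close> contains no constant from the comparison of \<open>N\<close> with the
  ambient norm: finite dimension enters only to know that the suprema that define the dual
  norm and the matrix norm are finite.
\<close>

section \<open>Coordinates in the space of finitely supported sequences\<close>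

lemma lookup_scaleR: "Poly_Mapping.lookup (r *\<^sub>R x) i = r *\<^sub>R Poly_Mapping.lookup x i"
proof -
  have "finite {i. r *\<^sub>R Poly_Mapping.lookup x i \<noteq> 0}"
    by (rule finite_subset[OF _ finite_lookup[of x]]) auto
  then show ?thesis
    by (simp add: scaleR_poly_mapping_def Abs_poly_mapping_inverse)
qed

lemma norm_lookup_le: "norm (Poly_Mapping.lookup x i) \<le> norm x"
proof (cases "i \<in> Poly_Mapping.keys x")
  case True
  then show ?thesis
    by (auto simp: norm_poly_mapping_def dist_poly_mapping_def intro!: member_le_sum)
next
  case False
  then show ?thesis
    by (simp add: in_keys_iff)
qed

lemma bounded_linear_lookup: "bounded_linear (\<lambda>x. Poly_Mapping.lookup x i)"
  by (rule bounded_linear_intro[where K = 1])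
     (simp_all add: lookup_add lookup_scaleR norm_lookup_le)

lemma Rn_zero: "0 \<in> Rn n"
  and Rn_add: "x \<in> Rn n \<Longrightarrow> y \<in> Rn n \<Longrightarrow> x + y \<in> Rn n"
  and Rn_diff: "x \<in> Rn n \<Longrightarrow> y \<in> Rn n \<Longrightarrow> x - y \<in> Rn n"
  and Rn_scaleR: "x \<in> Rn n \<Longrightarrow> c *\<^sub>R x \<in> Rn n"
  by (simp_all add: Rn_def lookup_add lookup_minus lookup_scaleR)

lemma Rn_sum: "(\<And>i. i \<in> I \<Longrightarrow> g i \<in> Rn n) \<Longrightarrow> (\<Sum>i\<in>I. g i) \<in> Rn n"
  by (induction I rule: infinite_finite_induct) (auto intro: Rn_zero Rn_add)

lemma unit_vec_in_Rn: "i < n \<Longrightarrow> unit_vec i \<in> Rn n"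
  by (simp add: Rn_def unit_vec_def lookup_single when_def)

lemma lookup_unit_vec: "Poly_Mapping.lookup (unit_vec j) i = (if i = j then 1 else 0)"
  by (simp add: unit_vec_def lookup_single when_def)

lemma norm_unit_vec: "norm (unit_vec i) = 1"
  by (simp add: unit_vec_def norm_poly_mapping_def dist_poly_mapping_def)

lemma lookup_sum_unit_vec:
  "Poly_Mapping.lookup (\<Sum>j<n. c j *\<^sub>R unit_vec j) i = (if i < n then c i else 0)"
  by (simp add: lookup_sum lookup_scaleR lookup_unit_vec if_distrib[of "(*) _"] cong: if_cong)

lemma Rn_expansion:
  assumes "x \<in> Rn n"
  shows "x = (\<Sum>j<n. Poly_Mapping.lookup x j *\<^sub>R unit_vec j)"
  using assms by (intro poly_mapping_eqI) (auto simp: lookup_sum_unit_vec Rn_def)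

lemma bounded_linear_scalar_prod_left: "bounded_linear (\<lambda>x. scalar_prod n x y)"
  unfolding scalar_prod_def
  by (intro bounded_linear_sum bounded_linear_mult_left[THEN bounded_linear_compose]
      bounded_linear_lookup)

lemma scalar_prod_commute: "scalar_prod n x y = scalar_prod n y x"
  by (simp add: scalar_prod_def mult.commute)

lemma bounded_linear_scalar_prod_right: "bounded_linear (\<lambda>y. scalar_prod n x y)"
  using bounded_linear_scalar_prod_left[of n x] by (simp add: scalar_prod_commute)

lemmas scalar_prod_linear =
  bounded_linear.linear[OF bounded_linear_scalar_prod_left, THEN linear_add]
  bounded_linear.linear[OF bounded_linear_scalar_prod_left, THEN linear_diff]
  bounded_linear.linear[OF bounded_linear_scalar_prod_left, THEN linear_scale]
  bounded_linear.linear[OF bounded_linear_scalar_prod_left, THEN linear_0]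
  bounded_linear.linear[OF bounded_linear_scalar_prod_right, THEN linear_add]
  bounded_linear.linear[OF bounded_linear_scalar_prod_right, THEN linear_diff]
  bounded_linear.linear[OF bounded_linear_scalar_prod_right, THEN linear_scale]
  bounded_linear.linear[OF bounded_linear_scalar_prod_right, THEN linear_0]

lemma scalar_prod_gradient:
  assumes "f differentiable (at x within Rn n)" "h \<in> Rn n"
  shows "scalar_prod n (gradient n f x) h = frechet_derivative f (at x within Rn n) h"
proof -
  interpret D: bounded_linear "frechet_derivative f (at x within Rn n)"
    using assms(1) frechet_derivative_works has_derivative_bounded_linear by blast
  have "frechet_derivative f (at x within Rn n) h =
      (\<Sum>j<n. Poly_Mapping.lookup h j * frechet_derivative f (at x within Rn n) (unit_vec j))"
    by (subst Rn_expansion[OF assms(2)]) (simp add: D.sum D.scaleR)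
  then show ?thesis
    by (simp add: scalar_prod_def gradient_def lookup_sum_unit_vec mult.commute)
qed

section \<open>Norms on coordinate subspaces\<close>

text \<open>
  The ambient space is infinite dimensional, where closed balls are not compact.  The box is
  compact because \<open>n\<close> successive products with \<open>{-1..1}\<close> exhaust it.
\<close>
lemma compact_coordinate_box:
  "compact {x \<in> Rn n. \<forall>i. \<bar>Poly_Mapping.lookup x i\<bar> \<le> 1}" (is "compact (?K n)")
proof (induction n)
  case 0
  have "?K 0 = {0}"
    by (auto simp: Rn_def intro: poly_mapping_eqI)
  then show ?case by simp
next
  case (Suc n)
  have "?K (Suc n) = (\<lambda>(c, x). c *\<^sub>R unit_vec n + x) ` ({-1..1} \<times> ?K n)" (is "_ = ?g ` _")
  proof (intro equalityI subsetI)
    fix x assume x: "x \<in> ?K (Suc n)"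
    define c where "c = Poly_Mapping.lookup x n"
    have "x - c *\<^sub>R unit_vec n \<in> ?K n"
      using x by (auto simp: Rn_def lookup_minus lookup_scaleR lookup_unit_vec c_def)
    moreover have "c \<in> {-1..1}"
      using x by (auto simp: c_def abs_le_iff minus_le_iff)
    moreover have "x = ?g (c, x - c *\<^sub>R unit_vec n)"
      by simp
    ultimately show "x \<in> ?g ` ({-1..1} \<times> ?K n)"
      by blast
  next
    fix x assume "x \<in> ?g ` ({-1..1} \<times> ?K n)"
    then obtain c y where "x = c *\<^sub>R unit_vec n + y" "\<bar>c\<bar> \<le> 1" "y \<in> ?K n"
      by auto
    then show "x \<in> ?K (Suc n)"
      by (auto simp: Rn_def lookup_add lookup_scaleR lookup_unit_vec)
  qed
  moreover have "compact (?g ` ({-1..1} \<times> ?K n))"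
    unfolding case_prod_unfold
    by (intro compact_continuous_image compact_Times compact_Icc Suc.IH continuous_intros)
  ultimately show ?case by simp
qed

lemma
  assumes "norm_on n N"
  shows norm_on_nonneg: "x \<in> Rn n \<Longrightarrow> 0 \<le> N x"
    and norm_on_eq_0_iff: "x \<in> Rn n \<Longrightarrow> N x = 0 \<longleftrightarrow> x = 0"
    and norm_on_scaleR: "x \<in> Rn n \<Longrightarrow> N (c *\<^sub>R x) = \<bar>c\<bar> * N x"
    and norm_on_triangle: "x \<in> Rn n \<Longrightarrow> y \<in> Rn n \<Longrightarrow> N (x + y) \<le> N x + N y"
  using assms unfolding norm_on_def by blast+

lemma norm_on_sum:
  assumes "norm_on n N" "\<And>i. i \<in> I \<Longrightarrow> g i \<in> Rn n"
  shows "N (\<Sum>i\<in>I. g i) \<le> (\<Sum>i\<in>I. N (g i))"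
  using assms(2)
proof (induction I rule: infinite_finite_induct)
  case (insert j I)
  then have "N (\<Sum>i\<in>insert j I. g i) \<le> N (g j) + N (\<Sum>i\<in>I. g i)"
    using norm_on_triangle[OF assms(1)] by (simp add: Rn_sum)
  then show ?case using insert by simp
qed (use norm_on_eq_0_iff[OF assms(1) Rn_zero] in auto)

lemma norm_on_le_norm:
  assumes "norm_on n N" "x \<in> Rn n"
  shows "N x \<le> (\<Sum>i<n. N (unit_vec i)) * norm x"
proof -
  have "N x = N (\<Sum>i<n. Poly_Mapping.lookup x i *\<^sub>R unit_vec i)"
    using Rn_expansion[OF assms(2)] by simp
  also have "\<dots> \<le> (\<Sum>i<n. N (Poly_Mapping.lookup x i *\<^sub>R unit_vec i))"
    by (intro norm_on_sum[OF assms(1)] Rn_scaleR unit_vec_in_Rn) auto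
  also have "\<dots> \<le> (\<Sum>i<n. N (unit_vec i) * norm x)"
  proof (intro sum_mono)
    fix i assume "i \<in> {..<n}"
    then have i: "unit_vec i \<in> Rn n" by (simp add: unit_vec_in_Rn)
    then show "N (Poly_Mapping.lookup x i *\<^sub>R unit_vec i) \<le> N (unit_vec i) * norm x"
      using mult_left_mono[OF norm_lookup_le[of x i] norm_on_nonneg[OF assms(1) i]]
      by (simp add: norm_on_scaleR[OF assms(1) i] mult.commute)
  qed
  finally show ?thesis by (simp add: sum_distrib_right)
qed

lemma continuous_on_norm_on:
  assumes "norm_on n N"
  shows "continuous_on (Rn n) N"
proof -
  define M where "M = (\<Sum>i<n. N (unit_vec i))"
  have M: "0 \<le> M"
    unfolding M_def using norm_on_nonneg[OF assms unit_vec_in_Rn] by (intro sum_nonneg) auto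
  have tri: "N x - N y \<le> M * norm (x - y)" if "x \<in> Rn n" "y \<in> Rn n" for x y
    using norm_on_triangle[OF assms Rn_diff[OF that] that(2)]
      norm_on_le_norm[OF assms Rn_diff[OF that]] by (simp add: M_def)
  have "M-lipschitz_on (Rn n) N"
  proof (rule lipschitz_onI)
    fix x y assume "x \<in> Rn n" "y \<in> Rn n"
    then show "dist (N x) (N y) \<le> M * dist x y"
      using tri[of x y] tri[of y x] by (simp add: dist_norm abs_le_iff norm_minus_commute)
  qed (rule M)
  then show ?thesis by (rule lipschitz_on_continuous_on)
qed

text \<open>
  The half of the equivalence of norms that needs finite dimension: \<open>N\<close> is continuous and positive
  on the compact unit sphere of \<open>Rn n\<close>, so it has a positive minimum there.  This is what makes the
  suprema in \<open>dual_norm\<close> and \<open>matrix_norm\<close> range over bounded sets; without boundedness a real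
  supremum is an arbitrary number and a bound on it carries no information.
\<close>
lemma lookup_le_norm_on:
  assumes "norm_on n N"
  obtains c where "0 \<le> c" "\<And>x i. x \<in> Rn n \<Longrightarrow> \<bar>Poly_Mapping.lookup x i\<bar> \<le> c * N x"
proof (cases "n = 0")
  case True
  show thesis
    by (rule that[of 0]) (auto simp: True Rn_def)
next
  case False
  define S where "S = {x \<in> Rn n. \<forall>i. \<bar>Poly_Mapping.lookup x i\<bar> \<le> 1} \<inter> {x. norm x = 1}"
  have "closed {x::rvec. norm x = 1}"
    by (intro closed_Collect_eq continuous_intros)
  then have "compact S"
    unfolding S_def by (intro compact_Int_closed compact_coordinate_box)
  moreover have "unit_vec 0 \<in> S"
    using False by (simp add: S_def unit_vec_in_Rn lookup_unit_vec norm_unit_vec)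
  moreover have "continuous_on S N"
    using continuous_on_norm_on[OF assms] by (rule continuous_on_subset) (auto simp: S_def)
  ultimately obtain z where z: "z \<in> S" "\<And>y. y \<in> S \<Longrightarrow> N z \<le> N y"
    using continuous_attains_inf[of S N] by auto
  have zR: "z \<in> Rn n" "z \<noteq> 0" using z(1) by (auto simp: S_def)
  then have pos: "0 < N z"
    using norm_on_nonneg[OF assms] norm_on_eq_0_iff[OF assms] by (metis order_le_less)
  show thesis
  proof (rule that[of "1 / N z"])
    fix x i assume x: "x \<in> Rn n"
    show "\<bar>Poly_Mapping.lookup x i\<bar> \<le> 1 / N z * N x"
    proof (cases "x = 0")
      case True
      then show ?thesis using norm_on_eq_0_iff[OF assms x] by simp
    next
      case False
      define y where "y = (1 / norm x) *\<^sub>R x"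
      have y1: "norm y = 1" "y \<in> Rn n" using False x by (simp_all add: y_def Rn_scaleR)
      then have "y \<in> S"
        using norm_lookup_le[of y] by (auto simp: S_def)
      then have "N z \<le> N x / norm x"
        using z(2)[of y] norm_on_scaleR[OF assms x, of "1 / norm x"] by (simp add: y_def)
      then have "norm x \<le> N x / N z"
        using False pos by (simp add: field_simps)
      then show ?thesis using norm_lookup_le[of x i] by simp
    qed
  qed (use pos in simp)
qed

lemma scalar_prod_le_dual_norm:
  assumes "norm_on n N" "h \<in> Rn n"
  shows "scalar_prod n s h \<le> dual_norm n N s * N h"
    and "bdd_above (scalar_prod n s ` {h \<in> Rn n. N h \<le> 1})"
proof -
  obtain c where c: "0 \<le> c" "\<And>x i. x \<in> Rn n \<Longrightarrow> \<bar>Poly_Mapping.lookup x i\<bar> \<le> c * N x"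
    using lookup_le_norm_on[OF assms(1)] by blast
  show bdd: "bdd_above (scalar_prod n s ` {h \<in> Rn n. N h \<le> 1})"
  proof (rule bdd_aboveI2)
    fix u assume u: "u \<in> {h \<in> Rn n. N h \<le> 1}"
    show "scalar_prod n s u \<le> (\<Sum>i<n. \<bar>Poly_Mapping.lookup s i\<bar> * c)"
      unfolding scalar_prod_def
    proof (intro sum_mono)
      fix i
      have "c * N u \<le> c * 1" using u c(1) by (intro mult_left_mono) auto
      then have "\<bar>Poly_Mapping.lookup u i\<bar> \<le> c" using c(2)[of u i] u by auto
      then have "\<bar>Poly_Mapping.lookup s i\<bar> * \<bar>Poly_Mapping.lookup u i\<bar> \<le> \<bar>Poly_Mapping.lookup s i\<bar> * c"
        by (intro mult_left_mono) auto
      then show "Poly_Mapping.lookup s i * Poly_Mapping.lookup u i \<le> \<bar>Poly_Mapping.lookup s i\<bar> * c"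
        by (metis abs_ge_self abs_mult order_trans)
    qed
  qed
  show "scalar_prod n s h \<le> dual_norm n N s * N h"
  proof (cases "h = 0")
    case True
    then show ?thesis using norm_on_eq_0_iff[OF assms] by (simp add: scalar_prod_linear)
  next
    case False
    then have pos: "0 < N h"
      using norm_on_nonneg[OF assms] norm_on_eq_0_iff[OF assms] by (metis order_le_less)
    have "(1 / N h) *\<^sub>R h \<in> {h \<in> Rn n. N h \<le> 1}"
      using pos norm_on_scaleR[OF assms, of "1 / N h"] by (simp add: Rn_scaleR assms)
    then have "scalar_prod n s ((1 / N h) *\<^sub>R h) \<le> dual_norm n N s"
      unfolding dual_norm_def using bdd by (rule cSUP_upper)
    then show ?thesis using pos by (simp add: scalar_prod_linear field_simps)
  qed
qed

lemma bdd_above_dual_norms: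
  assumes "norm_on n N" "linear A"
  shows "bdd_above ((\<lambda>h. dual_norm n N (A h)) ` {h \<in> Rn n. N h \<le> 1})"
proof -
  obtain c where c: "0 \<le> c" "\<And>x i. x \<in> Rn n \<Longrightarrow> \<bar>Poly_Mapping.lookup x i\<bar> \<le> c * N x"
    using lookup_le_norm_on[OF assms(1)] by blast
  let ?B = "\<Sum>i<n. (\<Sum>j<n. c * \<bar>Poly_Mapping.lookup (A (unit_vec j)) i\<bar>) * c"
  have c1: "\<bar>Poly_Mapping.lookup u i\<bar> \<le> c" if "u \<in> {h \<in> Rn n. N h \<le> 1}" for u i
  proof -
    have "c * N u \<le> c * 1" using that c(1) by (intro mult_left_mono) auto
    then show ?thesis using c(2)[of u i] that by auto
  qed
  show ?thesis
  proof (rule bdd_aboveI2)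
    fix h assume h: "h \<in> {h \<in> Rn n. N h \<le> 1}"
    then have hR: "h \<in> Rn n" by simp
    have Ah: "\<bar>Poly_Mapping.lookup (A h) i\<bar> \<le> (\<Sum>j<n. c * \<bar>Poly_Mapping.lookup (A (unit_vec j)) i\<bar>)" for i
    proof -
      have "A h = (\<Sum>j<n. Poly_Mapping.lookup h j *\<^sub>R A (unit_vec j))"
        by (subst Rn_expansion[OF hR])
           (simp add: linear_sum[OF assms(2)] linear_scale[OF assms(2)])
      then have "\<bar>Poly_Mapping.lookup (A h) i\<bar> \<le>
          (\<Sum>j<n. \<bar>Poly_Mapping.lookup h j * Poly_Mapping.lookup (A (unit_vec j)) i\<bar>)"
        by (simp add: lookup_sum lookup_scaleR sum_abs)
      also have "\<dots> \<le> (\<Sum>j<n. c * \<bar>Poly_Mapping.lookup (A (unit_vec j)) i\<bar>)"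
        unfolding abs_mult by (intro sum_mono mult_right_mono c1[OF h]) auto
      finally show ?thesis .
    qed
    have "0 \<in> {h \<in> Rn n. N h \<le> 1}"
      using norm_on_eq_0_iff[OF assms(1) Rn_zero] by (simp add: Rn_zero)
    then show "dual_norm n N (A h) \<le> ?B"
      unfolding dual_norm_def
    proof (intro cSUP_least)
      fix u assume u: "u \<in> {h \<in> Rn n. N h \<le> 1}"
      show "scalar_prod n (A h) u \<le> ?B"
        unfolding scalar_prod_def
      proof (intro sum_mono)
        fix i
        have "Poly_Mapping.lookup (A h) i * Poly_Mapping.lookup u i
            \<le> \<bar>Poly_Mapping.lookup (A h) i\<bar> * \<bar>Poly_Mapping.lookup u i\<bar>"
          by (metis abs_ge_self abs_mult)
        also have "\<dots> \<le> (\<Sum>j<n. c * \<bar>Poly_Mapping.lookup (A (unit_vec j)) i\<bar>) * c"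
          using c(1) by (intro mult_mono Ah c1[OF u] sum_nonneg) auto
        finally show "Poly_Mapping.lookup (A h) i * Poly_Mapping.lookup u i
            \<le> (\<Sum>j<n. c * \<bar>Poly_Mapping.lookup (A (unit_vec j)) i\<bar>) * c" .
      qed
    qed auto
  qed
qed

text \<open>
  The only way in which the Hoelder condition on the Hessian is used: an estimate on the bilinear
  form of a matrix, with no reference to suprema.
\<close>
lemma scalar_prod_le_matrix_norm:
  assumes "norm_on n N" "linear A" "h \<in> Rn n" "u \<in> Rn n"
  shows "scalar_prod n (A h) u \<le> matrix_norm n N A * N h * N u"
proof (cases "h = 0")
  case True
  then show ?thesis
    using norm_on_eq_0_iff[OF assms(1,3)] by (simp add: linear_0[OF assms(2)] scalar_prod_linear)
next
  case False
  then have pos: "0 < N h"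
    using norm_on_nonneg[OF assms(1,3)] norm_on_eq_0_iff[OF assms(1,3)] by (metis order_le_less)
  define e where "e = (1 / N h) *\<^sub>R h"
  have e: "e \<in> {h \<in> Rn n. N h \<le> 1}"
    using pos assms by (simp add: e_def Rn_scaleR norm_on_scaleR)
  have "scalar_prod n (A e) u \<le> dual_norm n N (A e) * N u"
    by (rule scalar_prod_le_dual_norm[OF assms(1,4)])
  also have "\<dots> \<le> matrix_norm n N A * N u"
    unfolding matrix_norm_def
    by (intro mult_right_mono cSUP_upper[OF e] bdd_above_dual_norms assms
        norm_on_nonneg[OF assms(1,4)])
  finally have "N h * scalar_prod n (A e) u \<le> N h * (matrix_norm n N A * N u)"
    using pos by (intro mult_left_mono) auto
  then show ?thesis
    using pos by (simp add: e_def linear_scale[OF assms(2)] scalar_prod_linear mult_ac)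
qed


section \<open>Derivatives along lines and symmetry of the Hessian\<close>

text \<open>
  The derivatives at hand are relative to \<open>Rn n\<close>, which has empty interior in the ambient space.
  Lines inside \<open>Rn n\<close> turn them into ordinary derivatives of functions of one real variable, to
  which the mean value theorem applies.
\<close>
lemma has_vector_derivative_along_line:
  assumes "g differentiable (at (p + t *\<^sub>R d) within Rn n)" "p \<in> Rn n" "d \<in> Rn n"
  shows "((\<lambda>s. g (p + s *\<^sub>R d)) has_vector_derivative
    frechet_derivative g (at (p + t *\<^sub>R d) within Rn n) d) (at t)"
proof -
  let ?g' = "frechet_derivative g (at (p + t *\<^sub>R d) within Rn n)"
  have g': "(g has_derivative ?g') (at (p + t *\<^sub>R d) within Rn n)"
    using assms(1) frechet_derivative_works by blast
  have "((\<lambda>s. p + s *\<^sub>R d) has_derivative (\<lambda>s. s *\<^sub>R d)) (at t)"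
    by (auto intro!: derivative_eq_intros)
  moreover have "(g has_derivative ?g') (at (p + t *\<^sub>R d) within range (\<lambda>s. p + s *\<^sub>R d))"
    using assms(2,3) by (intro has_derivative_subset[OF g']) (auto intro!: Rn_add Rn_scaleR)
  ultimately have "((\<lambda>s. g (p + s *\<^sub>R d)) has_derivative (\<lambda>s. ?g' (s *\<^sub>R d))) (at t)"
    by (rule has_derivative_in_compose)
  then show ?thesis
    by (simp add: has_vector_derivative_def linear_scale[OF has_derivative_linear[OF g']])
qed

lemma has_real_derivative_along_line:
  assumes "f differentiable (at (p + t *\<^sub>R d) within Rn n)" "p \<in> Rn n" "d \<in> Rn n"
  shows "((\<lambda>s. f (p + s *\<^sub>R d)) has_real_derivative
    scalar_prod n (gradient n f (p + t *\<^sub>R d)) d) (at t)"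
  using has_vector_derivative_along_line[OF assms] scalar_prod_gradient[OF assms(1,3)]
  by (simp add: has_real_derivative_iff_has_vector_derivative)

lemma has_real_derivative_gradient_along_line:
  assumes "gradient n f differentiable (at (p + t *\<^sub>R d) within Rn n)" "p \<in> Rn n" "d \<in> Rn n"
  shows "((\<lambda>s. scalar_prod n (gradient n f (p + s *\<^sub>R d)) u) has_real_derivative
    scalar_prod n (hessian n f (p + t *\<^sub>R d) d) u) (at t)"
  using bounded_linear.has_vector_derivative[OF bounded_linear_scalar_prod_left
      has_vector_derivative_along_line[OF assms], of n u]
  by (simp add: has_real_derivative_iff_has_vector_derivative hessian_def)

lemma linear_hessian:
  assumes "gradient n f differentiable (at x within Rn n)"
  shows "linear (hessian n f x)"
  using assms frechet_derivative_works has_derivative_linear unfolding hessian_def by blast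

text \<open>
  The numerator is the increment over \<open>[0, t]\<close> of
  \<open>s \<mapsto> f (x + s *\<^sub>R d + t *\<^sub>R w) - f (x + s *\<^sub>R d)\<close>.  By the mean value theorem it is \<open>t\<close> times a
  difference of two directional derivatives, taken at points within distance \<open>O(t)\<close> of \<open>x\<close>; that
  difference is \<open>t\<close> times the second derivative up to \<open>o(t)\<close>, by differentiability of the gradient
  at \<open>x\<close>.  The quotient is symmetric in \<open>d\<close> and \<open>w\<close>, so its limit is as well.
\<close>
lemma second_difference_quotient:
  assumes U: "open U" "x \<in> U" "\<And>y. y \<in> U \<inter> Rn n \<Longrightarrow> f differentiable (at y within Rn n)"
    and grad: "gradient n f differentiable (at x within Rn n)"
    and x: "x \<in> Rn n" and d: "d \<in> Rn n" and w: "w \<in> Rn n"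
  shows "((\<lambda>t. (f (x + t *\<^sub>R d + t *\<^sub>R w) - f (x + t *\<^sub>R d) - f (x + t *\<^sub>R w) + f x) / t\<^sup>2)
    \<longlongrightarrow> scalar_prod n (hessian n f x w) d) (at_right 0)" (is "(?Q \<longlongrightarrow> ?q) _")
proof (rule tendstoI)
  fix e :: real assume e: "0 < e"
  define G where "G y = scalar_prod n (gradient n f y) d" for y
  define B where "B h = scalar_prod n (hessian n f x h) d" for h
  \<comment> \<open>The two points compared lie within \<open>t * norm d + t * norm w\<close> and \<open>t * norm d\<close> of \<open>x\<close>, so the
  remainders add up to at most \<open>t * M\<close> times the precision; the \<open>1\<close> keeps \<open>M\<close> positive.\<close>
  define M where "M = 2 * norm d + norm w + 1"
  have M: "0 < M" by (simp add: M_def add_nonneg_pos)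
  have linB: "linear B"
    unfolding B_def by (rule linear_compose[OF linear_hessian[OF grad], unfolded o_def])
      (rule bounded_linear.linear[OF bounded_linear_scalar_prod_left])
  have "(gradient n f has_derivative hessian n f x) (at x within Rn n)"
    using grad frechet_derivative_works unfolding hessian_def by blast
  then have "(G has_derivative B) (at x within Rn n)"
    unfolding G_def B_def by (rule bounded_linear.has_derivative[OF bounded_linear_scalar_prod_left])
  moreover have "0 < e / (2 * M)" using e M by simp
  ultimately obtain r1 where r1: "0 < r1"
    "\<And>y. y \<in> Rn n \<Longrightarrow> norm (y - x) < r1 \<Longrightarrow> \<bar>G y - G x - B (y - x)\<bar> \<le> e / (2 * M) * norm (y - x)"
    unfolding has_derivative_within_alt real_norm_def by blast
  obtain r2 where r2: "0 < r2" "ball x r2 \<subseteq> U"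
    using U(1,2) openE by blast
  define r where "r = min r1 r2 / M"
  have r: "0 < r" using r1(1) r2(1) M by (simp add: r_def)
  have "dist (?Q t) ?q < e" if t: "0 < t" "t < r" for t
  proof -
    have tM: "t * M < r1" "t * M < r2"
      using t(2) M by (simp_all add: r_def field_simps)
    have small: "norm (s *\<^sub>R d + c *\<^sub>R w) \<le> t * norm d + \<bar>c\<bar> * norm w" if "0 \<le> s" "s \<le> t" for s c
      using that norm_triangle_ineq[of "s *\<^sub>R d" "c *\<^sub>R w"] mult_right_mono[OF that(2), of "norm d"]
      by simp
    have small2: "norm (s *\<^sub>R d + c *\<^sub>R w) < min r1 r2" if "0 \<le> s" "s \<le> t" "c \<in> {0, t}" for s c
    proof -
      have "\<bar>c\<bar> * norm w \<le> t * norm w" using that(3) t(1) by auto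
      moreover have "t * norm d + t * norm w \<le> t * M"
        using t(1) by (simp add: M_def distrib_left)
      ultimately show ?thesis
        using small[OF that(1,2), of c] tM by simp
    qed
    have inR: "x + s *\<^sub>R d + c *\<^sub>R w \<in> Rn n" for s c
      using x d w by (intro Rn_add Rn_scaleR)
    have deriv: "((\<lambda>s. f (x + s *\<^sub>R d + c *\<^sub>R w)) has_real_derivative G (x + s *\<^sub>R d + c *\<^sub>R w)) (at s)"
      if "0 \<le> s" "s \<le> t" "c \<in> {0, t}" for s c
    proof -
      have "x + s *\<^sub>R d + c *\<^sub>R w \<in> U \<inter> Rn n"
        using small2[OF that] r2(2) inR
        by (auto simp: subset_iff dist_norm norm_minus_commute add.assoc)
      then have "f differentiable (at ((x + c *\<^sub>R w) + s *\<^sub>R d) within Rn n)"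
        using U(3) by (simp add: add_ac)
      from has_real_derivative_along_line[OF this] x w d show ?thesis
        by (simp add: Rn_add Rn_scaleR G_def add_ac)
    qed
    \<comment> \<open>The summands \<open>0 *\<^sub>R _\<close> bring all four points into the form covered by \<open>deriv\<close>.\<close>
    have "\<exists>s. 0 < s \<and> s < t \<and>
        (f (x + t *\<^sub>R d + t *\<^sub>R w) - f (x + t *\<^sub>R d + 0 *\<^sub>R w))
          - (f (x + 0 *\<^sub>R d + t *\<^sub>R w) - f (x + 0 *\<^sub>R d + 0 *\<^sub>R w))
        = (t - 0) * (G (x + s *\<^sub>R d + t *\<^sub>R w) - G (x + s *\<^sub>R d + 0 *\<^sub>R w))"
      using t(1) by (intro MVT2 DERIV_diff deriv) auto
    then obtain s where s: "0 < s" "s < t"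
      and mvt: "f (x + t *\<^sub>R d + t *\<^sub>R w) - f (x + t *\<^sub>R d) - (f (x + t *\<^sub>R w) - f x)
        = t * (G (x + s *\<^sub>R d + t *\<^sub>R w) - G (x + s *\<^sub>R d))"
      by auto
    have "?Q t * t\<^sup>2 = f (x + t *\<^sub>R d + t *\<^sub>R w) - f (x + t *\<^sub>R d) - (f (x + t *\<^sub>R w) - f x)"
      using t(1) by simp
    from this mvt have Q: "?Q t * t\<^sup>2 = t * (G (x + s *\<^sub>R d + t *\<^sub>R w) - G (x + s *\<^sub>R d))"
      by (rule trans)
    have "\<bar>G (x + s *\<^sub>R d + t *\<^sub>R w) - G x - B (s *\<^sub>R d + t *\<^sub>R w)\<bar> \<le> e / (2 * M) * norm (s *\<^sub>R d + t *\<^sub>R w)"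
      using r1(2)[OF inR[of s t]] small2[of s t] s by (simp add: add.assoc)
    also have "\<dots> \<le> e / (2 * M) * (t * norm d + t * norm w)"
      using small[of s t] s t e M by (intro mult_left_mono) auto
    finally have 1: "\<bar>G (x + s *\<^sub>R d + t *\<^sub>R w) - G x - B (s *\<^sub>R d + t *\<^sub>R w)\<bar>
      \<le> e / (2 * M) * (t * norm d + t * norm w)" .
    have "\<bar>G (x + s *\<^sub>R d) - G x - B (s *\<^sub>R d)\<bar> \<le> e / (2 * M) * norm (s *\<^sub>R d)"
      using r1(2)[OF inR[of s 0]] small2[of s 0] s by (simp add: add.assoc)
    also have "\<dots> \<le> e / (2 * M) * (t * norm d)"
      using small[of s 0] s t e M by (intro mult_left_mono) auto
    finally have 2: "\<bar>G (x + s *\<^sub>R d) - G x - B (s *\<^sub>R d)\<bar> \<le> e / (2 * M) * (t * norm d)" .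
    have "B (s *\<^sub>R d + t *\<^sub>R w) = B (s *\<^sub>R d) + t * ?q"
      by (simp add: linear_add[OF linB] linear_scale[OF linB]) (simp add: B_def)
    then have "\<bar>G (x + s *\<^sub>R d + t *\<^sub>R w) - G (x + s *\<^sub>R d) - t * ?q\<bar>
        \<le> e / (2 * M) * (t * norm d + t * norm w) + e / (2 * M) * (t * norm d)"
      using 1 2 by linarith
    also have "\<dots> = e * t / 2 * ((2 * norm d + norm w) / M)"
      using M by (simp add: field_simps)
    also have "\<dots> \<le> e * t / 2 * 1"
      using M e t by (intro mult_left_mono) (auto simp: M_def)
    finally have "t * \<bar>G (x + s *\<^sub>R d + t *\<^sub>R w) - G (x + s *\<^sub>R d) - t * ?q\<bar> \<le> t * (e * t / 2)"
      using t(1) by (intro mult_left_mono) auto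
    moreover have "t * \<bar>G (x + s *\<^sub>R d + t *\<^sub>R w) - G (x + s *\<^sub>R d) - t * ?q\<bar> = t\<^sup>2 * \<bar>?Q t - ?q\<bar>"
    proof -
      have "t\<^sup>2 * (?Q t - ?q) = ?Q t * t\<^sup>2 - ?q * t\<^sup>2"
        by (simp only: left_diff_distrib mult.commute[of "t\<^sup>2"])
      also have "\<dots> = t * (G (x + s *\<^sub>R d + t *\<^sub>R w) - G (x + s *\<^sub>R d) - t * ?q)"
        unfolding Q by (simp add: right_diff_distrib power2_eq_square)
      finally have "t * (G (x + s *\<^sub>R d + t *\<^sub>R w) - G (x + s *\<^sub>R d) - t * ?q) = t\<^sup>2 * (?Q t - ?q)"
        by (rule sym)
      then have "\<bar>t * (G (x + s *\<^sub>R d + t *\<^sub>R w) - G (x + s *\<^sub>R d) - t * ?q)\<bar> = \<bar>t\<^sup>2 * (?Q t - ?q)\<bar>"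
        by (rule arg_cong)
      then show ?thesis using t(1) by (simp only: abs_mult abs_of_pos abs_power2)
    qed
    ultimately have "t\<^sup>2 * \<bar>?Q t - ?q\<bar> \<le> t\<^sup>2 * (e / 2)"
      by (simp add: power2_eq_square mult_ac)
    then have "\<bar>?Q t - ?q\<bar> \<le> e / 2"
      using t(1) mult_le_cancel_left_pos[of "t\<^sup>2"] by simp
    then show ?thesis using e by (simp add: dist_real_def)
  qed
  then show "\<forall>\<^sub>F t in at_right 0. dist (?Q t) ?q < e"
    using r eventually_at_right_less by (auto simp: eventually_at_right_field)
qed

text \<open>
  Symmetry is needed because \<open>newton_model\<close> contains the quadratic form of the Hessian, whose
  derivative involves the symmetric part of the matrix, while the linearization of the gradient
  involves the matrix itself.
\<close>
lemma hessian_symmetric: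
  assumes "twice_cont_diff_at n f x" "x \<in> Rn n" "d \<in> Rn n" "w \<in> Rn n"
  shows "scalar_prod n (hessian n f x w) d = scalar_prod n (hessian n f x d) w"
proof -
  obtain U where U: "open U" "x \<in> U"
    "\<And>y. y \<in> U \<inter> Rn n \<Longrightarrow> f differentiable (at y within Rn n)"
    "gradient n f differentiable (at x within Rn n)"
    using assms(1,2) unfolding twice_cont_diff_at_def by blast
  have lim: "((\<lambda>t. (f (x + t *\<^sub>R a + t *\<^sub>R b) - f (x + t *\<^sub>R a) - f (x + t *\<^sub>R b) + f x) / t\<^sup>2)
      \<longlongrightarrow> scalar_prod n (hessian n f x b) a) (at_right 0)" if "a \<in> Rn n" "b \<in> Rn n" for a b
    using second_difference_quotient[OF U(1,2) _ U(4) assms(2) that] U(3) by blast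
  have "(\<lambda>t. (f (x + t *\<^sub>R w + t *\<^sub>R d) - f (x + t *\<^sub>R w) - f (x + t *\<^sub>R d) + f x) / t\<^sup>2)
      = (\<lambda>t. (f (x + t *\<^sub>R d + t *\<^sub>R w) - f (x + t *\<^sub>R d) - f (x + t *\<^sub>R w) + f x) / t\<^sup>2)"
    by (simp add: algebra_simps)
  with lim[OF assms(4,3)] lim[OF assms(3,4)] show ?thesis
    by (intro tendsto_unique[OF trivial_limit_at_right_real]) simp_all
qed

section \<open>First-order convexity and linearization of the gradient\<close>

lemma convex_on_above_tangent:
  assumes "convex_on S f" "S \<subseteq> Rn n" "f differentiable (at x within Rn n)" "x \<in> S" "y \<in> S"
  shows "f x + scalar_prod n (gradient n f x) (y - x) \<le> f y"
proof -
  have "f differentiable (at (x + 0 *\<^sub>R (y - x)) within Rn n)"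
    using assms(3) by simp
  from has_real_derivative_along_line[OF this]
  have "((\<lambda>s. f (x + s *\<^sub>R (y - x))) has_real_derivative
      scalar_prod n (gradient n f x) (y - x)) (at 0)"
    using assms by (auto intro: Rn_diff)
  then have "((\<lambda>t. (f (x + t *\<^sub>R (y - x)) - f x) / t) \<longlongrightarrow>
      scalar_prod n (gradient n f x) (y - x)) (at_right 0)"
    by (simp add: DERIV_def filterlim_at_split)
  moreover have "\<forall>\<^sub>F t in at_right (0::real). (f (x + t *\<^sub>R (y - x)) - f x) / t \<le> f y - f x"
  proof -
    have "(f (x + t *\<^sub>R (y - x)) - f x) / t \<le> f y - f x" if "0 < t" "t < 1" for t
    proof -
      have "f ((1 - t) *\<^sub>R x + t *\<^sub>R y) \<le> (1 - t) * f x + t * f y"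
        using that assms(4,5) by (intro convex_onD[OF assms(1)]) auto
      moreover have "(1 - t) *\<^sub>R x + t *\<^sub>R y = x + t *\<^sub>R (y - x)"
        by (simp add: algebra_simps)
      ultimately show ?thesis using that(1) by (simp add: field_simps)
    qed
    then show ?thesis
      by (auto simp: eventually_at_right_field intro!: exI[of _ 1])
  qed
  ultimately have "scalar_prod n (gradient n f x) (y - x) \<le> f y - f x"
    by (rule tendsto_upperbound) simp
  then show ?thesis by simp
qed

text \<open>
  Integrating the Hoelder condition along the segment would improve the bound by the factor
  \<open>1 / (1 + \<nu>)\<close>.  For \<open>\<nu> \<le> 1\<close> this factor is at least \<open>1/2\<close>, so it affects only the absolute constant, and
  the mean value theorem for the scalar function \<open>t \<mapsto> \<langle>\<nabla>f (x + t (y - x)), u\<rangle>\<close> is enough.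
\<close>
lemma gradient_linearization_error:
  assumes N: "norm_on n N"
    and S: "convex S" "S \<subseteq> Rn n" "\<And>z. z \<in> S \<Longrightarrow> gradient n f differentiable (at z within Rn n)"
    and Hoelder: "hessian_Hoelder n N f S \<nu> H" "0 \<le> \<nu>" "0 \<le> H"
    and x: "x \<in> S" and y: "y \<in> S" and u: "u \<in> Rn n"
  shows "scalar_prod n (gradient n f y - gradient n f x - hessian n f x (y - x)) u
    \<le> H * N (y - x) powr (1 + \<nu>) * N u"
proof -
  define d where "d = y - x"
  have dR: "d \<in> Rn n" and xR: "x \<in> Rn n"
    using x y S(2) by (auto simp: d_def intro: Rn_diff)
  have seg: "x + t *\<^sub>R d \<in> S" if "0 \<le> t" "t \<le> 1" for t
  proof -
    have "(1 - t) *\<^sub>R x + t *\<^sub>R y \<in> S" using that x y by (intro convexD_alt[OF S(1)])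
    then show ?thesis by (simp add: d_def algebra_simps)
  qed
  have "\<exists>t. 0 < t \<and> t < 1 \<and>
      scalar_prod n (gradient n f (x + 1 *\<^sub>R d)) u - scalar_prod n (gradient n f (x + 0 *\<^sub>R d)) u
        = (1 - 0) * scalar_prod n (hessian n f (x + t *\<^sub>R d) d) u"
    by (intro MVT2 has_real_derivative_gradient_along_line S(3) seg dR xR) auto
  then obtain t where t: "0 < t" "t < 1" and mvt:
      "scalar_prod n (gradient n f y) u - scalar_prod n (gradient n f x) u
        = scalar_prod n (hessian n f (x + t *\<^sub>R d) d) u"
    by (auto simp: d_def)
  define z where "z = x + t *\<^sub>R d"
  have z: "z \<in> S" unfolding z_def using t by (intro seg) auto
  have "linear (\<lambda>h. hessian n f z h - hessian n f x h)"
    by (intro linear_compose_sub linear_hessian S(3) x z)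
  from scalar_prod_le_matrix_norm[OF N this dR u]
  have "scalar_prod n (hessian n f z d - hessian n f x d) u
      \<le> matrix_norm n N (\<lambda>h. hessian n f z h - hessian n f x h) * N d * N u" .
  also have "\<dots> \<le> (H * N (z - x) powr \<nu>) * N d * N u"
    using Hoelder(1) x z norm_on_nonneg[OF N] dR u
    unfolding hessian_Hoelder_def by (intro mult_right_mono) auto
  also have "\<dots> \<le> (H * N d powr \<nu>) * N d * N u"
  proof (intro mult_right_mono mult_left_mono powr_mono2)
    show "N (z - x) \<le> N d"
      using t norm_on_nonneg[OF N dR]
      by (simp add: z_def norm_on_scaleR[OF N dR] mult_left_le_one_le)
  qed (use Hoelder norm_on_nonneg[OF N] dR u xR z S(2) in \<open>auto intro: Rn_diff\<close>)
  also have "\<dots> = H * N d powr (1 + \<nu>) * N u"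
    using norm_on_nonneg[OF N dR] by (simp add: powr_add powr_one mult_ac)
  finally show ?thesis
    by (simp add: scalar_prod_linear mvt[symmetric] z_def d_def[symmetric])
qed


section \<open>One contracted Newton step\<close>

lemma nonneg_linear_coeff:
  fixes a b :: real
  assumes "\<And>t. 0 < t \<Longrightarrow> t < 1 \<Longrightarrow> 0 \<le> t * a + t\<^sup>2 * b"
  shows "0 \<le> a"
proof -
  have "((\<lambda>t. a + t * b) \<longlongrightarrow> a + 0 * b) (at_right 0)"
    by (intro tendsto_intros)
  moreover have "\<forall>\<^sub>F t in at_right 0. 0 \<le> a + t * b"
  proof -
    have "0 \<le> a + t * b" if "0 < t" "t < 1" for t
    proof -
      have "0 \<le> t * (a + t * b)"
        using assms[OF that] by (simp add: algebra_simps power2_eq_square)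
      then show ?thesis using that(1) by (simp add: zero_le_mult_iff)
    qed
    then show ?thesis
      by (auto simp: eventually_at_right_field intro!: exI[of _ 1])
  qed
  ultimately have "0 \<le> a + 0 * b"
    by (rule tendsto_lowerbound) simp
  then show ?thesis by simp
qed

text \<open>
  Inside the locale, \<open>p\<close> is the real-valued part of \<open>\<psi>\<close> on its domain, where all points that the
  method visits lie, and \<open>diam\<close> is the diameter \<open>D\<close>.
\<close>
locale Hoelder_composite_problem =
  fixes n :: nat and N :: "rvec \<Rightarrow> real" and f :: "rvec \<Rightarrow> real" and \<psi> :: "rvec \<Rightarrow> ereal"
    and \<nu> H :: real
  assumes norm: "norm_on n N"
    and psi: "proper_closed_convex n \<psi>"
    and convex: "convex_on (edom n \<psi>) f"
    and smooth: "\<And>y. y \<in> edom n \<psi> \<Longrightarrow> twice_cont_diff_at n f y"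
    and bounded: "bdd_above (dom_distances n N \<psi>)"
    and nu: "0 \<le> \<nu>" and H: "0 \<le> H"
    and Hoelder: "hessian_Hoelder n N f (edom n \<psi>) \<nu> H"
begin

definition p :: "rvec \<Rightarrow> real"
  where "p y = real_of_ereal (\<psi> y)"

definition diam :: real
  where "diam = Sup (dom_distances n N \<psi>)"

lemma edom_subset: "edom n \<psi> \<subseteq> Rn n"
  by (auto simp: edom_def)

lemma psi_eq: "y \<in> edom n \<psi> \<Longrightarrow> \<psi> y = ereal (p y)"
  using psi by (cases "\<psi> y") (auto simp: edom_def p_def proper_closed_convex_def)

lemma psi_infinite: "y \<in> Rn n \<Longrightarrow> y \<notin> edom n \<psi> \<Longrightarrow> \<psi> y = \<infinity>"
  by (auto simp: edom_def)

lemma diff_f: "y \<in> edom n \<psi> \<Longrightarrow> f differentiable (at y within Rn n)"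
  and diff_gradient: "y \<in> edom n \<psi> \<Longrightarrow> gradient n f differentiable (at y within Rn n)"
  using smooth edom_subset unfolding twice_cont_diff_at_def by blast+

lemma segment_in_edom:
  assumes "x \<in> edom n \<psi>" "y \<in> edom n \<psi>" "0 \<le> t" "t \<le> 1"
  shows "x + t *\<^sub>R (y - x) \<in> edom n \<psi>"
    and "p (x + t *\<^sub>R (y - x)) \<le> (1 - t) * p x + t * p y"
proof -
  have "(x, p x) \<in> ereal_epigraph n \<psi>" "(y, p y) \<in> ereal_epigraph n \<psi>"
    using assms(1,2) psi_eq edom_subset by (auto simp: ereal_epigraph_def)
  moreover have "convex (ereal_epigraph n \<psi>)"
    using psi by (simp add: proper_closed_convex_def)
  ultimately have "(1 - t) *\<^sub>R (x, p x) + t *\<^sub>R (y, p y) \<in> ereal_epigraph n \<psi>"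
    using assms(3,4) by (intro convexD_alt)
  moreover have "(1 - t) *\<^sub>R x + t *\<^sub>R y = x + t *\<^sub>R (y - x)"
    by (simp add: algebra_simps)
  ultimately have "x + t *\<^sub>R (y - x) \<in> Rn n"
    and le: "\<psi> (x + t *\<^sub>R (y - x)) \<le> ereal ((1 - t) * p x + t * p y)"
    by (auto simp: ereal_epigraph_def)
  then show mem: "x + t *\<^sub>R (y - x) \<in> edom n \<psi>"
    using ereal_infty_less_eq(1) by (force simp: edom_def less_top[symmetric] top_ereal_def)
  show "p (x + t *\<^sub>R (y - x)) \<le> (1 - t) * p x + t * p y"
    using le psi_eq[OF mem] by simp
qed

lemma convex_edom: "convex (edom n \<psi>)"
  using convex by (rule convex_on_imp_convex)

lemma dist_le_diam: "x \<in> edom n \<psi> \<Longrightarrow> y \<in> edom n \<psi> \<Longrightarrow> N (x - y) \<le> diam"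
  unfolding diam_def by (intro cSup_upper bounded) (auto simp: dom_distances_def)

lemma diam_nonneg: "0 \<le> diam"
proof -
  obtain y where y: "y \<in> edom n \<psi>"
    using psi by (auto simp: proper_closed_convex_def)
  show ?thesis
    using dist_le_diam[OF y y] norm_on_eq_0_iff[OF norm Rn_zero] by simp
qed

text \<open>
  The first-order optimality condition of the Newton subproblem, obtained by comparing \<open>v\<close> with
  \<open>v + t *\<^sub>R (y - v)\<close> for small \<open>t\<close>: the smooth part contributes its derivative up to \<open>O(t\<^sup>2)\<close>, and
  \<open>p\<close> increases by at most \<open>t * (p y - p v)\<close> by convexity.
\<close>
lemma newton_model_minimizer:
  assumes x: "x \<in> edom n \<psi>"
    and v: "is_arg_min (newton_model n f \<psi> g x) (\<lambda>y. y \<in> Rn n) v"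
  shows "v \<in> edom n \<psi>"
    and "y \<in> edom n \<psi> \<Longrightarrow>
      p v \<le> scalar_prod n (gradient n f x + g *\<^sub>R hessian n f x (v - x)) (y - v) + p y"
proof -
  define q where "q y = scalar_prod n (gradient n f x) (y - x)
    + g / 2 * scalar_prod n (hessian n f x (y - x)) (y - x)" for y
  have model: "newton_model n f \<psi> g x y = ereal (q y) + \<psi> y" for y
    by (simp add: newton_model_def q_def)
  have min: "ereal (q v) + \<psi> v \<le> ereal (q y) + \<psi> y" if "y \<in> Rn n" for y
    using v that by (auto simp: is_arg_min_def model[symmetric] not_less)
  have "ereal (q v) + \<psi> v \<le> ereal (q x) + ereal (p x)"
    using min[of x] x edom_subset psi_eq[OF x] by auto
  then have "\<psi> v \<noteq> \<infinity>" by auto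
  then show vdom: "v \<in> edom n \<psi>"
    using v by (auto simp: edom_def is_arg_min_def)
  show "p v \<le> scalar_prod n (gradient n f x + g *\<^sub>R hessian n f x (v - x)) (y - v) + p y"
    if y: "y \<in> edom n \<psi>"
  proof -
    define d where "d = y - v"
    define w where "w = v - x"
    have dw: "d \<in> Rn n" "w \<in> Rn n"
      using x y vdom edom_subset by (auto simp: d_def w_def intro: Rn_diff)
    have lin: "linear (hessian n f x)"
      by (intro linear_hessian diff_gradient x)
    have sym: "scalar_prod n (hessian n f x d) w = scalar_prod n (hessian n f x w) d"
      using x dw edom_subset by (intro hessian_symmetric smooth) auto
    define a where "a = scalar_prod n (gradient n f x + g *\<^sub>R hessian n f x w) d + p y - p v"
    define b where "b = g / 2 * scalar_prod n (hessian n f x d) d"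
    have "0 \<le> t * a + t\<^sup>2 * b" if t: "0 < t" "t < 1" for t
    proof -
      have yt: "v + t *\<^sub>R d \<in> edom n \<psi>" "p (v + t *\<^sub>R d) \<le> (1 - t) * p v + t * p y"
        unfolding d_def using segment_in_edom[OF vdom y] t by auto
      have "q v + p v \<le> q (v + t *\<^sub>R d) + p (v + t *\<^sub>R d)"
        using min[of "v + t *\<^sub>R d"] yt(1) edom_subset psi_eq[OF yt(1)] psi_eq[OF vdom] by auto
      moreover have "q (v + t *\<^sub>R d) = q v + t * scalar_prod n (gradient n f x) d
          + g * t * scalar_prod n (hessian n f x w) d + t\<^sup>2 * b"
      proof -
        have "v + t *\<^sub>R d - x = w + t *\<^sub>R d" by (simp add: w_def)
        then have "q (v + t *\<^sub>R d) = scalar_prod n (gradient n f x) (w + t *\<^sub>R d)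
            + g / 2 * scalar_prod n (hessian n f x (w + t *\<^sub>R d)) (w + t *\<^sub>R d)"
          by (simp only: q_def)
        moreover have "q v = scalar_prod n (gradient n f x) w
            + g / 2 * scalar_prod n (hessian n f x w) w"
          by (simp only: q_def w_def)
        ultimately show ?thesis
          by (simp add: b_def linear_add[OF lin] linear_scale[OF lin]
              scalar_prod_linear sym) (simp add: algebra_simps power2_eq_square)
      qed
      ultimately show ?thesis
        using yt(2) by (simp add: a_def scalar_prod_linear algebra_simps)
    qed
    then have "0 \<le> a" by (rule nonneg_linear_coeff)
    then show ?thesis by (simp add: a_def d_def w_def)
  qed
qed

text \<open>
  Since \<open>g *\<^sub>R (v - x)\<close> is exactly the displacement \<open>x' - x\<close> to the next iterate \<open>x'\<close>, the gradient
  of the smooth part of the model at \<open>v\<close> is the linearization of the gradient of \<open>f\<close> at \<open>x'\<close>.  So \<open>v\<close> nearly minimizes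
  \<open>\<langle>\<nabla>f x', y\<rangle> + p y\<close>, that is, it nearly is a conditional gradient step that
  uses the gradient at the new point.  The defect carries the factor \<open>g powr (1 + \<nu>)\<close> because the
  displacement is at most \<open>g * diam\<close>.
\<close>
lemma contracted_newton_step:
  assumes x: "x \<in> edom n \<psi>" and g: "0 \<le> g" "g \<le> 1"
    and v: "is_arg_min (newton_model n f \<psi> g x) (\<lambda>y. y \<in> Rn n) v"
    and y: "y \<in> edom n \<psi>"
  shows "p v \<le> scalar_prod n (gradient n f (x + g *\<^sub>R (v - x))) (y - v) + p y
    + H * diam powr (2 + \<nu>) * g powr (1 + \<nu>)"
proof -
  define x' where "x' = x + g *\<^sub>R (v - x)"
  note vdom = newton_model_minimizer(1)[OF x v]
  have x': "x' \<in> edom n \<psi>"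
    unfolding x'_def using segment_in_edom(1)[OF x vdom] g by simp
  have R: "v - x \<in> Rn n" "v - y \<in> Rn n"
    using x y vdom edom_subset by (auto intro: Rn_diff)
  have hess: "hessian n f x (x' - x) = g *\<^sub>R hessian n f x (v - x)"
    using linear_scale[OF linear_hessian[OF diff_gradient[OF x]]] by (simp add: x'_def)
  have Nx': "N (x' - x) = g * N (v - x)"
    using g by (simp add: x'_def norm_on_scaleR[OF norm R(1)])
  have "scalar_prod n (gradient n f x' - gradient n f x - hessian n f x (x' - x)) (v - y)
      \<le> H * N (x' - x) powr (1 + \<nu>) * N (v - y)"
    by (intro gradient_linearization_error[OF norm convex_edom edom_subset] diff_gradient
        Hoelder nu H x x' R(2))
  also have "\<dots> \<le> H * (g * diam) powr (1 + \<nu>) * diam"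
    using nu H g R dist_le_diam[OF vdom x] dist_le_diam[OF vdom y] norm_on_nonneg[OF norm]
    unfolding Nx' by (intro mult_mono mult_left_mono powr_mono2 mult_nonneg_nonneg) auto
  also have "\<dots> = H * diam powr (2 + \<nu>) * g powr (1 + \<nu>)"
  proof -
    have "diam powr (2 + \<nu>) = diam powr (1 + \<nu>) * diam"
      using powr_add[of diam "1 + \<nu>" 1] diam_nonneg by (simp add: add_ac)
    then show ?thesis using g diam_nonneg by (simp add: powr_mult)
  qed
  finally have "scalar_prod n (gradient n f x' - gradient n f x - g *\<^sub>R hessian n f x (v - x)) (v - y)
      \<le> H * diam powr (2 + \<nu>) * g powr (1 + \<nu>)"
    by (simp add: hess)
  with newton_model_minimizer(2)[OF x v y] show ?thesis
    unfolding x'_def[symmetric] by (simp add: scalar_prod_linear algebra_simps)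
qed

end

section \<open>Estimating sequences\<close>

text \<open>
  Estimating sequences work for all weights that increase from \<open>0\<close>; the particular weights matter
  only for the size of \<open>error_bound\<close>.
\<close>
locale contracting_newton_iteration = Hoelder_composite_problem +
  fixes A :: "nat \<Rightarrow> real" and x :: "nat \<Rightarrow> rvec"
  assumes A_0: "A 0 = 0" and A_mono: "strict_mono A"
    and iterates: "contracting_domain_newton n f \<psi> (contraction_coeff A) x"
begin

lemma A_pos: "1 \<le> k \<Longrightarrow> 0 < A k"
  using strict_monoD[OF A_mono, of 0 k] A_0 by simp

lemma increment_pos: "1 \<le> i \<Longrightarrow> 0 < increment A i"
  using strict_monoD[OF A_mono, of "i - 1" i] by (simp add: increment_def)

lemma sum_increment: "(\<Sum>i=1..k. increment A i) = A k"
  by (induction k) (simp_all add: A_0 increment_def)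

lemma contraction_coeff_bounds: "0 < contraction_coeff A k" "contraction_coeff A k \<le> 1"
proof -
  have "0 \<le> A k" using A_pos[of k] A_0 by (cases "k = 0") auto
  then show "0 < contraction_coeff A k" "contraction_coeff A k \<le> 1"
    using A_pos[of "Suc k"] increment_pos[of "Suc k"]
    by (simp_all add: contraction_coeff_def increment_def)
qed

lemma obtain_newton_point:
  obtains v where "is_arg_min (newton_model n f \<psi> (contraction_coeff A k) (x k)) (\<lambda>y. y \<in> Rn n) v"
    "x (Suc k) = x k + contraction_coeff A k *\<^sub>R (v - x k)"
  using iterates unfolding contracting_domain_newton_def by blast

lemma iterate_in_edom: "x k \<in> edom n \<psi>"
proof (induction k)
  case 0
  then show ?case using iterates by (simp add: contracting_domain_newton_def)
next
  case (Suc k)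
  obtain v where v: "is_arg_min (newton_model n f \<psi> (contraction_coeff A k) (x k)) (\<lambda>y. y \<in> Rn n) v"
    "x (Suc k) = x k + contraction_coeff A k *\<^sub>R (v - x k)"
    by (rule obtain_newton_point)
  show ?case
    unfolding v(2) using contraction_coeff_bounds[of k]
    by (intro segment_in_edom(1) Suc newton_model_minimizer(1)[OF Suc v(1)]) auto
qed

definition F :: "rvec \<Rightarrow> real"
  where "F y = f y + p y"

text \<open>The function \<open>\<phi>\<^sub>k\<close>, with the real values that it takes on the domain of \<open>\<psi>\<close>.\<close>
definition \<Phi> :: "nat \<Rightarrow> rvec \<Rightarrow> real"
  where "\<Phi> k y = (\<Sum>i=1..k. increment A i *
    (f (x i) + scalar_prod n (gradient n f (x i)) (y - x i) + p y))"

definition error_bound :: "nat \<Rightarrow> real"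
  where "error_bound k = H * diam powr (2 + \<nu>) *
    (\<Sum>i=1..k. increment A i * contraction_coeff A (i - 1) powr (1 + \<nu>))"

text \<open>
  The induction step combines four facts about the new iterate \<open>x'\<close>: \<open>f\<close> lies above its tangent at
  \<open>x'\<close>; \<open>p x'\<close> is at most the convex combination of \<open>p (x k)\<close> and \<open>p v\<close>; \<open>v\<close> nearly
  minimizes the linearization at \<open>x'\<close> plus \<open>p\<close>; and \<open>A (Suc k) *\<^sub>R x'\<close> equals \<open>A k *\<^sub>R x k + a *\<^sub>R v\<close>,
  so that the increments of the tangent at \<open>x'\<close> towards \<open>x k\<close> and \<open>v\<close> cancel with these weights.  This last identity is the reason for the
  choice of \<open>contraction_coeff\<close>.
\<close>
lemma estimating_sequence:
  assumes y: "y \<in> edom n \<psi>"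
  shows "A k * F (x k) \<le> \<Phi> k y + error_bound k"
proof (induction k)
  case 0
  then show ?case by (simp add: A_0 \<Phi>_def error_bound_def)
next
  case (Suc k)
  define a where "a = increment A (Suc k)"
  define g where "g = contraction_coeff A k"
  define E where "E = H * diam powr (2 + \<nu>) * g powr (1 + \<nu>)"
  define x' where "x' = x (Suc k)"
  obtain v where v: "is_arg_min (newton_model n f \<psi> g (x k)) (\<lambda>y. y \<in> Rn n) v"
    and x'_eq: "x' = x k + g *\<^sub>R (v - x k)"
    using obtain_newton_point[of k] unfolding g_def x'_def by blast
  have A': "A (Suc k) = A k + a" by (simp add: a_def increment_def)
  \<comment> \<open>With \<open>x' - x k = g *\<^sub>R (v - x k)\<close>, this identity says that \<open>x'\<close> is the mean of \<open>x k\<close> and \<open>v\<close>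
  with weights \<open>A k\<close> and \<open>a\<close>.\<close>
  have ga: "g * (A k + a) = a"
    using A_pos[of "Suc k"] by (simp add: g_def contraction_coeff_def a_def[symmetric] A'[symmetric])
  have a: "0 \<le> a" using increment_pos[of "Suc k"] by (simp add: a_def)
  have Ak: "0 \<le> A k" using A_pos[of k] A_0 by (cases "k = 0") auto
  have g: "0 \<le> g" "g \<le> 1" using contraction_coeff_bounds[of k] by (auto simp: g_def)
  have vdom: "v \<in> edom n \<psi>" by (rule newton_model_minimizer(1)[OF iterate_in_edom v])
  have x'dom: "x' \<in> edom n \<psi>" by (simp add: x'_def iterate_in_edom)
  define s where "s z = scalar_prod n (gradient n f x') z" for z
  have "f x' + s (x k - x') \<le> f (x k)"
    unfolding s_def
    by (intro convex_on_above_tangent[OF convex edom_subset] diff_f x'dom iterate_in_edom)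
  then have 1: "A k * (f x' + s (x k - x')) \<le> A k * f (x k)"
    using Ak by (rule mult_left_mono)
  have "p x' \<le> (1 - g) * p (x k) + g * p v"
    unfolding x'_eq using g by (intro segment_in_edom(2) iterate_in_edom vdom)
  then have "(A k + a) * p x' \<le> (A k + a) * ((1 - g) * p (x k) + g * p v)"
    using Ak a by (intro mult_left_mono) auto
  also have "\<dots> = (A k + a - g * (A k + a)) * p (x k) + g * (A k + a) * p v"
    by (simp add: algebra_simps)
  finally have 2: "(A k + a) * p x' \<le> A k * p (x k) + a * p v"
    by (simp add: ga)
  have "p v \<le> s (y - v) + p y + E"
    using contracted_newton_step[OF iterate_in_edom g v y] by (simp add: x'_eq s_def E_def)
  then have 3: "a * p v \<le> a * (s (y - v) + p y + E)"
    using a by (rule mult_left_mono)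
  have 4: "A k * s (x k - x') + a * s (v - x') = 0"
  proof -
    have s_eq: "s (x k - x') = - g * s (v - x k)" "s (v - x') = (1 - g) * s (v - x k)"
      by (simp_all add: x'_eq s_def scalar_prod_linear algebra_simps)
    have "A k * s (x k - x') + a * s (v - x') = (a - g * (A k + a)) * s (v - x k)"
      unfolding s_eq
      by (simp add: algebra_simps)
    then show ?thesis by (simp add: ga)
  qed
  have 5: "s (y - x') = s (y - v) + s (v - x')"
    by (simp add: s_def scalar_prod_linear)
  have "\<Phi> (Suc k) y = \<Phi> k y + a * (f x' + s (y - x') + p y)"
    by (simp add: \<Phi>_def a_def x'_def s_def)
  moreover have "error_bound (Suc k) = error_bound k + a * E"
    by (simp add: error_bound_def a_def E_def g_def algebra_simps)
  moreover have "A (Suc k) * F (x (Suc k)) = (A k + a) * f x' + (A k + a) * p x'"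
    by (simp add: A' F_def x'_def algebra_simps)
  moreover have "A k * F (x k) = A k * f (x k) + A k * p (x k)"
    by (simp add: F_def algebra_simps)
  ultimately show ?case
    using Suc.IH 1 2 3 4 unfolding 5 by (simp add: algebra_simps)
qed

lemma \<Phi>_le:
  assumes y: "y \<in> edom n \<psi>"
  shows "\<Phi> k y \<le> A k * F y"
proof -
  have "\<Phi> k y \<le> (\<Sum>i=1..k. increment A i * F y)"
    unfolding \<Phi>_def F_def using increment_pos
    by (intro sum_mono mult_left_mono add_right_mono
        convex_on_above_tangent[OF convex edom_subset] diff_f iterate_in_edom y)
      (auto intro: less_imp_le)
  then show ?thesis unfolding sum_distrib_right[symmetric] sum_increment .
qed

lemma estimating_fun_eq:
  assumes "y \<in> edom n \<psi>"
  shows "estimating_fun n f \<psi> (increment A) x k y = ereal (\<Phi> k y)"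
  by (simp add: estimating_fun_def \<Phi>_def psi_eq[OF assms])

lemma estimating_fun_infinite:
  assumes "y \<in> Rn n" "y \<notin> edom n \<psi>" "1 \<le> k"
  shows "estimating_fun n f \<psi> (increment A) x k y = \<infinity>"
  unfolding estimating_fun_def sum_Pinfty psi_infinite[OF assms(1,2)]
  using assms(3) increment_pos[of 1] by (auto intro!: bexI[of _ 1])

lemma objective_eq: "y \<in> edom n \<psi> \<Longrightarrow> objective f \<psi> y = ereal (F y)"
  by (simp add: objective_def psi_eq F_def)

text \<open>
  Each summand of \<open>\<Phi> k y\<close> minorizes a multiple of \<open>F y\<close> by convexity, and the weights add up to \<open>A k\<close>, so
  \<open>\<Phi> k / A k\<close> is a lower model of the objective and its minimum a lower bound of the optimal value.
\<close>
theorem residual_le_certificate: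
  assumes k: "1 \<le> k"
  shows "objective f \<psi> (x k) - optimal_value n f \<psi> \<le> accuracy_certificate n f \<psi> A x k"
  unfolding accuracy_certificate_def
proof (rule ereal_minus_mono)
  show "estimating_min n f \<psi> (increment A) x k / ereal (A k) \<le> optimal_value n f \<psi>"
    unfolding optimal_value_def
  proof (rule INF_greatest)
    fix y assume y: "y \<in> Rn n"
    show "estimating_min n f \<psi> (increment A) x k / ereal (A k) \<le> objective f \<psi> y"
    proof (cases "y \<in> edom n \<psi>")
      case True
      have "estimating_min n f \<psi> (increment A) x k \<le> ereal (\<Phi> k y)"
        unfolding estimating_min_def using y by (intro INF_lower2[of y]) (simp_all add: estimating_fun_eq True)
      also have "\<dots> \<le> ereal (A k) * objective f \<psi> y"
        using \<Phi>_le[OF True] by (simp add: objective_eq[OF True])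
      finally show ?thesis
        using A_pos[OF k] by (simp add: ereal_divide_le_pos)
    next
      case False
      then show ?thesis by (simp add: objective_def psi_infinite[OF y])
    qed
  qed
qed simp

theorem certificate_le:
  assumes k: "1 \<le> k"
  shows "accuracy_certificate n f \<psi> A x k \<le> ereal (error_bound k / A k)"
proof -
  have low: "ereal (A k * F (x k) - error_bound k) \<le> estimating_min n f \<psi> (increment A) x k"
    unfolding estimating_min_def
  proof (rule INF_greatest)
    fix y assume y: "y \<in> Rn n"
    show "ereal (A k * F (x k) - error_bound k) \<le> estimating_fun n f \<psi> (increment A) x k y"
    proof (cases "y \<in> edom n \<psi>")
      case True
      then show ?thesis
        using estimating_sequence[OF True, of k] by (simp add: estimating_fun_eq)
    next
      case False
      then show ?thesis by (simp add: estimating_fun_infinite[OF y False k])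
    qed
  qed
  have "accuracy_certificate n f \<psi> A x k
      \<le> ereal (F (x k)) - ereal (A k * F (x k) - error_bound k) / ereal (A k)"
    unfolding accuracy_certificate_def objective_eq[OF iterate_in_edom]
    using A_pos[OF k] low by (intro ereal_minus_mono ereal_divide_right_mono) auto
  also have "\<dots> = ereal (error_bound k / A k)"
    using A_pos[OF k] by (simp add: field_simps)
  finally show ?thesis .
qed

end

section \<open>Cubic weights\<close>

lemma cubic_increment_le: "increment cubic_weight (Suc j) \<le> 3 * (real (Suc j))\<^sup>2"
  by (simp add: increment_def cubic_weight_def algebra_simps power3_eq_cube power2_eq_square)

lemma cubic_contraction_le: "contraction_coeff cubic_weight j \<le> 3 / real (Suc j)"
  using divide_right_mono[OF cubic_increment_le[of j], of "real (Suc j) ^ 3"]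
  by (simp add: contraction_coeff_def cubic_weight_def power3_eq_cube power2_eq_square)

lemma strict_mono_cubic_weight: "strict_mono cubic_weight"
  by (rule strict_monoI) (simp add: cubic_weight_def power_strict_mono)

text \<open>
  The increments grow like \<open>3 i\<^sup>2\<close> and the contraction coefficients decay like \<open>3 / i\<close>, so each
  summand is at most \<open>3 * 3 powr (1 + \<nu>) * i powr (1 - \<nu>)\<close>.  With \<open>\<nu> \<le> 1\<close> the constant
  is at most \<open>27\<close>, and the last factor is largest at \<open>i = k\<close>.
\<close>
lemma cubic_error_sum_le:
  assumes "0 \<le> \<nu>" "\<nu> \<le> 1"
  shows "(\<Sum>i=1..k. increment cubic_weight i * contraction_coeff cubic_weight (i - 1) powr (1 + \<nu>))
    \<le> 27 * real k powr (2 - \<nu>)"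
proof -
  have "increment cubic_weight i * contraction_coeff cubic_weight (i - 1) powr (1 + \<nu>)
      \<le> 27 * real k powr (1 - \<nu>)" (is "?s i \<le> _") if i: "i \<in> {1..k}" for i
  proof -
    obtain j where j: "i = Suc j" using i by (cases i) auto
    have inc0: "0 < increment cubic_weight i"
      using strict_monoD[OF strict_mono_cubic_weight, of j i] by (simp add: increment_def j)
    then have con0: "0 \<le> contraction_coeff cubic_weight j"
      by (simp add: contraction_coeff_def j cubic_weight_def)
    have "contraction_coeff cubic_weight j powr (1 + \<nu>) \<le> (3 / real i) powr (1 + \<nu>)"
      using assms con0 cubic_contraction_le[of j] by (intro powr_mono2) (auto simp: j)
    also have "\<dots> = 3 powr (1 + \<nu>) / real i powr (1 + \<nu>)"
      by (simp add: powr_divide)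
    also have "\<dots> \<le> 3 powr 2 / real i powr (1 + \<nu>)"
      using assms by (intro divide_right_mono powr_mono) auto
    finally have con: "contraction_coeff cubic_weight j powr (1 + \<nu>) \<le> 9 / real i powr (1 + \<nu>)"
      by simp
    have "increment cubic_weight i * contraction_coeff cubic_weight j powr (1 + \<nu>)
        \<le> 3 * (real i)\<^sup>2 * (9 / real i powr (1 + \<nu>))"
      using cubic_increment_le[of j] con inc0 by (intro mult_mono) (auto simp: j)
    also have "\<dots> = 27 * (real i powr 2 / real i powr (1 + \<nu>))"
      using i by simp
    also have "\<dots> = 27 * real i powr (1 - \<nu>)"
      using powr_diff[of "real i" 2 "1 + \<nu>"] by simp
    also have "\<dots> \<le> 27 * real k powr (1 - \<nu>)"
      using i assms by (intro mult_left_mono powr_mono2) auto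
    finally show ?thesis by (simp add: j)
  qed
  then have "sum ?s {1..k} \<le> real (card {1..k}) * (27 * real k powr (1 - \<nu>))"
    by (rule sum_bounded_above)
  also have "\<dots> = 27 * (real k powr 1 * real k powr (1 - \<nu>))"
    by simp
  also have "\<dots> = 27 * real k powr (2 - \<nu>)"
    by (simp only: powr_add[symmetric]) simp
  finally show ?thesis .
qed

text \<open>
  Any weights of order \<open>k ^ m\<close> with \<open>m > 1 + \<nu>\<close> would give the exponent \<open>1 + \<nu>\<close>; the cube is large
  enough for every \<open>\<nu> \<le> 1\<close>.
\<close>
theorem cubic_convergence_rate:
  assumes "Hoelder_composite_problem n N f \<psi> \<nu> H" "\<nu> \<le> 1"
    and "contracting_domain_newton n f \<psi> (contraction_coeff cubic_weight) x"
    and k: "1 \<le> k"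
  shows "objective f \<psi> (x k) - optimal_value n f \<psi> \<le> accuracy_certificate n f \<psi> cubic_weight x k"
    and "accuracy_certificate n f \<psi> cubic_weight x k
      \<le> ereal (27 * (H * Sup (dom_distances n N \<psi>) powr (2 + \<nu>) / real k powr (1 + \<nu>)))"
proof -
  interpret Hoelder_composite_problem n N f \<psi> \<nu> H by fact
  interpret contracting_newton_iteration n N f \<psi> \<nu> H cubic_weight x
    by unfold_locales (use assms(3) strict_mono_cubic_weight in \<open>auto simp: cubic_weight_def\<close>)
  show "objective f \<psi> (x k) - optimal_value n f \<psi> \<le> accuracy_certificate n f \<psi> cubic_weight x k"
    by (rule residual_le_certificate[OF k])
  have "error_bound k / cubic_weight k
      \<le> H * diam powr (2 + \<nu>) * (27 * real k powr (2 - \<nu>)) / cubic_weight k"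
    unfolding error_bound_def using H nu assms(2) A_pos[OF k]
    by (intro divide_right_mono mult_left_mono cubic_error_sum_le) auto
  also have "\<dots> = 27 * (H * diam powr (2 + \<nu>) * (real k powr (2 - \<nu>) / real k powr 3))"
    using k by (simp add: cubic_weight_def)
  also have "real k powr (2 - \<nu>) / real k powr 3 = real k powr - (1 + \<nu>)"
    using powr_diff[of "real k" "2 - \<nu>" 3] by simp
  also have "\<dots> = 1 / real k powr (1 + \<nu>)"
    by (rule powr_minus_divide)
  finally show "accuracy_certificate n f \<psi> cubic_weight x k
      \<le> ereal (27 * (H * Sup (dom_distances n N \<psi>) powr (2 + \<nu>) / real k powr (1 + \<nu>)))"
    using order_trans[OF certificate_le[OF k]] by (simp add: diam_def)
qed

lemma cubic_contraction_eq: "contraction_coeff cubic_weight k = 1 - (real k / real (k + 1)) ^ 3"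
  by (simp add: contraction_coeff_def increment_def cubic_weight_def diff_divide_distrib power_divide)

lemma cubic_contraction_bigo: "contraction_coeff cubic_weight \<in> O(\<lambda>k. 1 / real k)"
proof (rule bigoI[where c = 3])
  have "norm (contraction_coeff cubic_weight k) \<le> 3 * norm (1 / real k)" if "1 \<le> k" for k
  proof -
    have "0 \<le> contraction_coeff cubic_weight k"
      by (simp add: cubic_contraction_eq power_le_one)
    moreover have "3 / real (Suc k) \<le> 3 / real k"
      using that by (intro divide_left_mono) auto
    ultimately show ?thesis
      using cubic_contraction_le[of k] by simp
  qed
  then show "\<forall>\<^sub>F k in sequentially. norm (contraction_coeff cubic_weight k) \<le> 3 * norm (1 / real k)"
    by (auto simp: eventually_sequentially)
qed

theorem theorem1:
  shows "(\<forall>k. contraction_coeff cubic_weight k = 1 - (real k / real (k + 1)) ^ 3) \<and>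
    contraction_coeff cubic_weight \<in> O(\<lambda>k. 1 / real k) \<and>
    (\<exists>C::real. C > 0 \<and>
      (\<forall>(n::nat) (N :: rvec \<Rightarrow> real) (f :: rvec \<Rightarrow> real) (\<psi> :: rvec \<Rightarrow> ereal)
          (\<nu>::real) (H::real) (x :: nat \<Rightarrow> rvec).
        norm_on n N \<and>
        proper_closed_convex n \<psi> \<and>
        convex_on (edom n \<psi>) f \<and>
        (\<forall>y\<in>edom n \<psi>. twice_cont_diff_at n f y) \<and>
        bdd_above (dom_distances n N \<psi>) \<and>
        0 \<le> \<nu> \<and> \<nu> \<le> 1 \<and> 0 \<le> H \<and>
        hessian_Hoelder n N f (edom n \<psi>) \<nu> H \<and>
        contracting_domain_newton n f \<psi> (contraction_coeff cubic_weight) x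
        \<longrightarrow>
        (\<forall>k\<ge>1.
          objective f \<psi> (x k) - optimal_value n f \<psi> \<le> accuracy_certificate n f \<psi> cubic_weight x k \<and>
          accuracy_certificate n f \<psi> cubic_weight x k
            \<le> ereal (C * (H * Sup (dom_distances n N \<psi>) powr (2 + \<nu>) / real k powr (1 + \<nu>))))))"
proof (intro conjI exI[of _ 27] allI impI; (elim conjE)?)
  fix n N f \<psi> \<nu> H x and k :: nat
  assume "norm_on n N" "proper_closed_convex n \<psi>" "convex_on (edom n \<psi>) f"
    "\<forall>y\<in>edom n \<psi>. twice_cont_diff_at n f y" "bdd_above (dom_distances n N \<psi>)"
    "0 \<le> \<nu>" "\<nu> \<le> 1" "0 \<le> H" "hessian_Hoelder n N f (edom n \<psi>) \<nu> H"
    and it: "contracting_domain_newton n f \<psi> (contraction_coeff cubic_weight) x" and "1 \<le> k"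
  then have problem: "Hoelder_composite_problem n N f \<psi> \<nu> H"
    by unfold_locales auto
  show "objective f \<psi> (x k) - optimal_value n f \<psi> \<le> accuracy_certificate n f \<psi> cubic_weight x k"
    by (rule cubic_convergence_rate(1)[OF problem \<open>\<nu> \<le> 1\<close> it \<open>1 \<le> k\<close>])
  show "accuracy_certificate n f \<psi> cubic_weight x k
      \<le> ereal (27 * (H * Sup (dom_distances n N \<psi>) powr (2 + \<nu>) / real k powr (1 + \<nu>)))"
    by (rule cubic_convergence_rate(2)[OF problem \<open>\<nu> \<le> 1\<close> it \<open>1 \<le> k\<close>])
qed (simp_all add: cubic_contraction_eq cubic_contraction_bigo)

end
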